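(* Let $G$ be a graph on $n$ vertices and let $S$ be a minimal connected dominating set of $G$ with $|S| \geq \frac{4}{10}n$. Then $|L(S)| \geq \frac{1}{20}n$, where $L(S) = \{v \in V(G) : v \text{ has at most } 2 \text{ neighbors in } S\}$.
   Context: All graphs are finite and simple. A vertex subset $S$ of $G$ is a dominating set if every vertex not in $S$ has a neighbor in $S$; it is a connected dominating set if moreover $G[S]$ is connected; a connected dominating set is minimal if no proper subset of it is a connected dominating set. *)

theory Defs
  imports Complex_Main "Graph_Theory.Digraph_Component"
begin

text \<open>
  Finite simple graphs are the instances of the locale \<^locale>\<open>graph\<close>: finite, loop-free
  symmetric digraphs without parallel arcs. So \<open>u \<rightarrow>\<^bsub>G\<^esub> v\<close> is adjacency and
  \<open>G \<restriction> S\<close> is the induced subgraph. The constant \<open>connected\<close> is qualified because the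
  topological notion of the same name is also in scope.
\<close>

definition neighbors :: "('a, 'b) pre_digraph \<Rightarrow> 'a \<Rightarrow> 'a set" where
  "neighbors G v = {u \<in> verts G. v \<rightarrow>\<^bsub>G\<^esub> u}"

definition dominating_set :: "('a, 'b) pre_digraph \<Rightarrow> 'a set \<Rightarrow> bool" where
  "dominating_set G S \<longleftrightarrow>
     S \<subseteq> verts G \<and> (\<forall>v \<in> verts G - S. \<exists>u \<in> S. u \<in> neighbors G v)"

definition connected_dominating_set :: "('a, 'b) pre_digraph \<Rightarrow> 'a set \<Rightarrow> bool" where
  "connected_dominating_set G S \<longleftrightarrow>
     dominating_set G S \<and> Digraph_Component.connected (G \<restriction> S)"

definition minimal_connected_dominating_set :: "('a, 'b) pre_digraph \<Rightarrow> 'a set \<Rightarrow> bool" where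
  "minimal_connected_dominating_set G S \<longleftrightarrow>
     connected_dominating_set G S \<and> (\<forall>T. T \<subset> S \<longrightarrow> \<not> connected_dominating_set G T)"

definition low_degree_vertices :: "('a, 'b) pre_digraph \<Rightarrow> 'a set \<Rightarrow> 'a set" where
  "low_degree_vertices G S = {v \<in> verts G. card (neighbors G v \<inter> S) \<le> 2}"

end

theory Submission
  imports Defs
begin

text \<open>
  Fix a breadth-first search tree of \<open>G[S]\<close> with \<open>\<ell>\<close> leaves. The sum of \<open>c(x) - 1\<close> over all
  vertices, where \<open>c(x)\<close> is the number of children of \<open>x\<close>, is \<open>-1\<close>, so at most \<open>\<ell> - 1\<close> vertices
  have more than one child, and these have at most \<open>2(\<ell> - 1)\<close> children in total. Let \<open>u\<close> have degree
  at least 3 in \<open>G[S]\<close>, at most one child, and a non-root parent \<open>x\<close> of which it is the only child. A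
  further neighbour \<open>v\<close> of \<open>u\<close> is no descendant of \<open>u\<close>, as levels of adjacent vertices differ by at
  most one; so the edge \<open>uv\<close> bypasses \<open>x\<close>, which therefore is not a cut vertex. Leaves are not cut
  vertices either. Hence if \<open>G[S]\<close> has \<open>k\<close> non-cut vertices, at most \<open>4k\<close> vertices have degree at least 3.

  By minimality every non-cut vertex of \<open>G[S]\<close> is the only neighbour in \<open>S\<close> of some vertex
  outside \<open>S\<close>. So \<open>|L(S)| \<ge> k + max 0 (|S| - 4k) \<ge> |S| / 4\<close>.
\<close>

text \<open>The empty set counts as connected here, unlike for induced subgraphs, so nonemptiness is
  carried separately.\<close>

definition connected_on :: "'a rel \<Rightarrow> 'a set \<Rightarrow> bool" where
  "connected_on E S \<longleftrightarrow> (\<forall>x\<in>S. \<forall>y\<in>S. (x, y) \<in> (Restr E S)\<^sup>*)"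

lemma connected_onI_root:
  assumes "sym E" and "\<And>w. w \<in> S \<Longrightarrow> (w, r) \<in> (Restr E S)\<^sup>*"
  shows "connected_on E S"
proof -
  have "sym ((Restr E S)\<^sup>*)"
    using assms(1) by (intro sym_rtrancl) (auto simp: sym_def)
  then show ?thesis
    unfolding connected_on_def using assms(2) by (blast intro: rtrancl_trans dest: symD)
qed

section \<open>Breadth-first search trees and removal of a vertex\<close>

locale bfs_tree =
  fixes E :: "'a rel" and S :: "'a set" and r :: 'a and p :: "'a \<Rightarrow> 'a" and lev :: "'a \<Rightarrow> nat"
  assumes finite_S: "finite S"
    and sym_E: "sym E"
    and irrefl_E: "(x, x) \<notin> E"
    and root: "r \<in> S"
    and parent_in: "\<lbrakk>u \<in> S; u \<noteq> r\<rbrakk> \<Longrightarrow> p u \<in> S"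
    and parent_edge: "\<lbrakk>u \<in> S; u \<noteq> r\<rbrakk> \<Longrightarrow> (u, p u) \<in> E"
    and lev_parent: "\<lbrakk>u \<in> S; u \<noteq> r\<rbrakk> \<Longrightarrow> lev u = Suc (lev (p u))"
    and lev_edge: "\<lbrakk>u \<in> S; v \<in> S; (u, v) \<in> E\<rbrakk> \<Longrightarrow> lev v \<le> Suc (lev u)"
begin

text \<open>Pairs point from child to parent, so the reflexive transitive closure relates each
  descendant to its ancestors.\<close>

definition P :: "'a rel" where
  "P = {(w, p w) | w. w \<in> S \<and> w \<noteq> r}"

definition children :: "'a \<Rightarrow> 'a set" where
  "children x = {u \<in> S. u \<noteq> r \<and> p u = x}"

lemma P_iff: "(w, x) \<in> P \<longleftrightarrow> w \<in> children x"
  by (auto simp: P_def children_def)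

lemma finite_children [simp]: "finite (children x)"
  using finite_S by (auto simp: children_def)

lemma lev_descendant: "(w, x) \<in> P\<^sup>* \<Longrightarrow> lev x \<le> lev w"
  by (induction rule: converse_rtrancl_induct) (auto simp: P_def dest: lev_parent)

lemma descendant_via_child:
  assumes "(w, x) \<in> P\<^sup>*" "w \<noteq> x"
  obtains u where "u \<in> children x" "(w, u) \<in> P\<^sup>*"
  using assms by (metis P_iff rtranclE)

text \<open>The parent of a non-descendant of \<open>x\<close> is again a non-descendant, so the
  climb to the root never meets \<open>x\<close>.\<close>

lemma path_to_root_avoiding:
  "\<lbrakk>w \<in> S; (w, x) \<notin> P\<^sup>*\<rbrakk> \<Longrightarrow> (w, r) \<in> (Restr E (S - {x}))\<^sup>*"
proof (induction "lev w" arbitrary: w rule: less_induct)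
  case less
  show ?case
  proof (cases "w = r")
    case False
    with less.prems have step: "(w, p w) \<in> P" by (auto simp: P_def)
    have not_desc: "(p w, x) \<notin> P\<^sup>*"
      using less.prems(2) step by (meson converse_rtrancl_into_rtrancl)
    have "(p w, r) \<in> (Restr E (S - {x}))\<^sup>*"
      using less.prems False not_desc by (intro less.hyps) (auto simp: lev_parent parent_in)
    moreover have "w \<noteq> x" "p w \<noteq> x" using less.prems(2) not_desc by auto
    then have "(w, p w) \<in> Restr E (S - {x})"
      using less.prems False by (auto simp: parent_in parent_edge)
    ultimately show ?thesis by (meson converse_rtrancl_into_rtrancl)
  qed simp
qed

lemma path_to_ancestor_avoiding:
  assumes "(w, u) \<in> P\<^sup>*" "lev x < lev u"
  shows "(w, u) \<in> (Restr E (S - {x}))\<^sup>*"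
  using assms(1)
proof (induction rule: converse_rtrancl_induct)
  case (step y z)
  then have y: "y \<in> S" "y \<noteq> r" "z = p y" by (auto simp: P_def)
  have "lev u \<le> lev z" "lev u \<le> lev y"
    using step lev_descendant by (auto intro: converse_rtrancl_into_rtrancl)
  with assms(2) have "y \<noteq> x" "z \<noteq> x" by auto
  with y have "(y, z) \<in> Restr E (S - {x})" by (auto simp: parent_in parent_edge)
  with step.IH show ?case by (meson converse_rtrancl_into_rtrancl)
qed simp

lemma root_ancestor: "w \<in> S \<Longrightarrow> (w, r) \<in> P\<^sup>*"
proof (induction "lev w" arbitrary: w rule: less_induct)
  case less
  show ?case
  proof (cases "w = r")
    case False
    then have "(w, p w) \<in> P" using less.prems by (auto simp: P_def)
    moreover have "(p w, r) \<in> P\<^sup>*"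
      using False less.prems by (intro less.hyps) (auto simp: lev_parent parent_in)
    ultimately show ?thesis by (meson converse_rtrancl_into_rtrancl)
  qed simp
qed

text \<open>A proper descendant of \<open>x\<close> climbs to a child \<open>u\<close> of
  \<open>x\<close>, crosses to \<open>v\<close> outside the subtree of \<open>x\<close>, and climbs
  on to the root. For a leaf \<open>x\<close> the bypass condition is vacuous.\<close>

lemma connected_on_remove:
  assumes "x \<in> S" "x \<noteq> r"
    and bypass: "\<And>u. u \<in> children x \<Longrightarrow> \<exists>v\<in>S. (u, v) \<in> E \<and> (v, x) \<notin> P\<^sup>*"
  shows "connected_on E (S - {x})"
proof (rule connected_onI_root[OF sym_E])
  fix w assume w: "w \<in> S - {x}"
  show "(w, r) \<in> (Restr E (S - {x}))\<^sup>*"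
  proof (cases "(w, x) \<in> P\<^sup>*")
    case True
    with w obtain u where u: "u \<in> children x" "(w, u) \<in> P\<^sup>*"
      by (auto elim: descendant_via_child)
    obtain v where v: "v \<in> S" "(u, v) \<in> E" "(v, x) \<notin> P\<^sup>*" using bypass u(1) by blast
    have u': "u \<in> S" "lev x < lev u"
      using u(1) lev_parent[of u] by (auto simp: children_def)
    then have "(w, u) \<in> (Restr E (S - {x}))\<^sup>*"
      using u(2) by (intro path_to_ancestor_avoiding)
    moreover have "(u, v) \<in> Restr E (S - {x})"
      using u' v by auto
    moreover have "(v, r) \<in> (Restr E (S - {x}))\<^sup>*"
      using v by (intro path_to_root_avoiding)
    ultimately show ?thesis by (meson rtrancl_into_rtrancl rtrancl_trans)
  qed (use w path_to_root_avoiding in auto)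
qed

lemma connected_on_remove_parent:
  assumes u: "u \<in> S" "u \<noteq> r" "p u \<noteq> r"
    and few: "card (children u) \<le> 1" "card (children (p u)) \<le> 1"
    and deg: "3 \<le> card (E `` {u} \<inter> S)"
  shows "connected_on E (S - {p u})"
proof (rule connected_on_remove)
  fix u' assume "u' \<in> children (p u)"
  moreover have "u \<in> children (p u)" using u by (auto simp: children_def)
  ultimately have "u' = u" using few(2) by (auto simp: card_le_Suc0_iff_eq)
  \<comment> \<open>The tree accounts for at most two neighbours of \<open>u\<close>, so degree 3
    supplies a non-tree edge to some \<open>v\<close>.\<close>
  have "card (insert (p u) (children u)) \<le> 2"
    using few(1) by (intro order.trans[OF card_insert_le_m1]) auto
  then have "\<not> E `` {u} \<inter> S \<subseteq> insert (p u) (children u)"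
    using deg card_mono[of "insert (p u) (children u)" "E `` {u} \<inter> S"] by auto
  then obtain v where v: "v \<in> S" "(u, v) \<in> E" "v \<noteq> p u" "v \<notin> children u" by auto
  have "(v, p u) \<notin> P\<^sup>*"
  proof
    assume "(v, p u) \<in> P\<^sup>*"
    then obtain z where z: "z \<in> children (p u)" "(v, z) \<in> P\<^sup>*"
      using v(3) by (auto elim: descendant_via_child)
    with few(2) \<open>u \<in> children (p u)\<close> have "(v, u) \<in> P\<^sup>*" by (auto simp: card_le_Suc0_iff_eq)
    moreover have "v \<noteq> u" using v(2) irrefl_E by auto
    ultimately obtain y where y: "y \<in> children u" "(v, y) \<in> P\<^sup>*"
      by (auto elim: descendant_via_child)
    with v(4) have "v \<noteq> y" by auto
    with y(2) obtain y' where y': "y' \<in> children y" "(v, y') \<in> P\<^sup>*"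
      by (auto elim: descendant_via_child)
    \<comment> \<open>A descendant of \<open>u\<close> that is neither \<open>u\<close> nor a child
      of \<open>u\<close> lies at least two levels below \<open>u\<close>, too deep to be adjacent
      to it.\<close>
    have "lev y' = Suc (Suc (lev u))"
      using y(1) y'(1) lev_parent[of y'] lev_parent[of y] by (auto simp: children_def)
    moreover have "lev v \<le> Suc (lev u)" using u v by (intro lev_edge)
    ultimately show False using lev_descendant[OF y'(2)] by simp
  qed
  with v \<open>u' = u\<close> show "\<exists>v\<in>S. (u', v) \<in> E \<and> (v, p u) \<notin> P\<^sup>*" by blast
qed (use u parent_in in auto)

section \<open>Counting leaves, branching vertices and vertices of degree at least 3\<close>

lemma sum_card_children: "(\<Sum>x\<in>S. card (children x)) = card S - 1"
proof -
  have "(\<Sum>x\<in>S. card (children x)) = card (\<Union>x\<in>S. children x)"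
    using finite_S by (intro card_UN_disjoint[symmetric]) (auto simp: children_def)
  also have "(\<Union>x\<in>S. children x) = S - {r}"
    using parent_in by (auto simp: children_def)
  finally show ?thesis using root by simp
qed

text \<open>In the sum of (number of children) - 1, which is -1, a leaf contributes -1 and a vertex
  with one child contributes 0. The negative terms are why the proof passes to integers.\<close>

lemma sum_branching:
  "(\<Sum>x | x \<in> S \<and> 2 \<le> card (children x). card (children x) - 1) + 1
     = card {x \<in> S. children x = {}}"
proof -
  let ?c = "\<lambda>x. card (children x)"
  let ?B = "{x \<in> S. 2 \<le> ?c x}" and ?L = "{x \<in> S. children x = {}}"
  have "(\<Sum>x\<in>S. int (?c x) - 1) =
      (\<Sum>x\<in>S. (if 2 \<le> ?c x then int (?c x - 1) else 0) - (if children x = {} then 1 else 0))"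
  proof (rule sum.cong)
    fix x
    have empty: "children x = {} \<longleftrightarrow> ?c x = 0" by simp
    show "int (?c x) - 1 =
        (if 2 \<le> ?c x then int (?c x - 1) else 0) - (if children x = {} then 1 else 0)"
      unfolding empty by arith
  qed simp
  also have "\<dots> = int (\<Sum>x\<in>?B. ?c x - 1) - int (card ?L)"
    using finite_S by (simp add: sum_subtractf sum.If_cases Int_def)
  finally have "(\<Sum>x\<in>S. int (?c x)) - int (card S) = int (\<Sum>x\<in>?B. ?c x - 1) - int (card ?L)"
    by (simp add: sum_subtractf)
  moreover have "(\<Sum>x\<in>S. int (?c x)) = int (card S) - 1"
  proof -
    have "0 < card S" using root finite_S by (auto simp: card_gt_0_iff)
    then show ?thesis using sum_card_children by (simp flip: of_nat_sum)
  qed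
  ultimately show ?thesis by linarith
qed

theorem card_degree_ge_3_le:
  assumes "2 \<le> card S"
  shows "card {u \<in> S. 3 \<le> card (E `` {u} \<inter> S)} \<le> 4 * card {x \<in> S. connected_on E (S - {x})}"
proof -
  let ?c = "\<lambda>x. card (children x)"
  define U where "U = {u \<in> S. 3 \<le> card (E `` {u} \<inter> S)}"
  define N where "N = {x \<in> S. connected_on E (S - {x})}"
  define L where "L = {x \<in> S. children x = {}}"
  define B where "B = {x \<in> S. 2 \<le> ?c x}"
  define M where "M = {x \<in> S. x \<noteq> r \<and> ?c x = 1 \<and> connected_on E (S - {x})}"
  \<comment> \<open>\<open>M\<close> excludes the root, so an only child of the root is collected
    here; if the root branches, its children are covered through \<open>B\<close>.\<close>
  define K where "K = (if ?c r \<le> 1 then children r else {})"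
  have fin: "finite U" "finite N" "finite L" "finite B" "finite M" "finite K"
    using finite_S by (auto simp: U_def N_def L_def B_def M_def K_def)
  \<comment> \<open>The root must not be a leaf, since removal of leaves is handled by a lemma about
    non-root vertices.\<close>
  have "children r \<noteq> {}"
  proof -
    have "S \<noteq> {r}" using assms by auto
    then obtain w where "w \<in> S" "w \<noteq> r" using root by blast
    then show ?thesis using root_ancestor descendant_via_child by (metis empty_iff)
  qed
  then have "r \<notin> L" by (simp add: L_def)
  have "L \<subseteq> N"
  proof
    fix x assume "x \<in> L"
    with \<open>r \<notin> L\<close> have "connected_on E (S - {x})"
      by (intro connected_on_remove) (auto simp: L_def)
    with \<open>x \<in> L\<close> show "x \<in> N" by (simp add: L_def N_def)
  qed
  then have "L \<union> M \<subseteq> N" by (auto simp: M_def N_def)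
  moreover have "L \<inter> M = {}" by (auto simp: L_def M_def)
  ultimately have LM: "card L + card M \<le> card N"
    using fin by (metis card_Un_disjoint card_mono)
  have "U \<subseteq> {r} \<union> L \<union> B \<union> (\<Union>x\<in>B. children x) \<union> K \<union> (\<Union>x\<in>M. children x)"
  proof
    fix u assume "u \<in> U"
    then have u: "u \<in> S" "3 \<le> card (E `` {u} \<inter> S)" by (auto simp: U_def)
    show "u \<in> {r} \<union> L \<union> B \<union> (\<Union>x\<in>B. children x) \<union> K \<union> (\<Union>x\<in>M. children x)"
    proof (cases "u = r \<or> u \<in> B \<or> p u \<in> B \<or> p u = r")
      case True
      then show ?thesis using u root by (auto simp: children_def B_def K_def)
    next
      case False
      with u have few: "?c u \<le> 1" "?c (p u) \<le> 1"
        using parent_in[of u] by (auto simp: B_def)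
      have "u \<in> children (p u)" using u False by (auto simp: children_def)
      then have "0 < ?c (p u)" by (auto simp: card_gt_0_iff)
      with few(2) have "?c (p u) = 1" by linarith
      with few u False have "p u \<in> M"
        using connected_on_remove_parent[of u] parent_in[of u] by (simp add: M_def)
      with \<open>u \<in> children (p u)\<close> show ?thesis by blast
    qed
  qed
  then have "card U \<le> card ({r} \<union> L \<union> B \<union> (\<Union>x\<in>B. children x) \<union> K \<union> (\<Union>x\<in>M. children x))"
    using fin by (intro card_mono) auto
  also have "\<dots> \<le> card {r} + card L + card B + card (\<Union>x\<in>B. children x) + card K
      + card (\<Union>x\<in>M. children x)"
    by (intro order.trans[OF card_Un_le] add_mono order.refl)
  also have "\<dots> \<le> 1 + card L + card B + (\<Sum>x\<in>B. ?c x) + 1 + card M"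
  proof -
    have "card (\<Union>x\<in>M. children x) \<le> (\<Sum>x\<in>M. ?c x)" using fin by (intro card_UN_le)
    also have "\<dots> = card M" by (simp add: M_def)
    finally have "card (\<Union>x\<in>M. children x) \<le> card M" .
    moreover have "card (\<Union>x\<in>B. children x) \<le> (\<Sum>x\<in>B. ?c x)" using fin by (intro card_UN_le)
    moreover have "card K \<le> 1" by (simp add: K_def)
    ultimately show ?thesis by simp
  qed
  also have "\<dots> \<le> 4 * card L + card M"
  proof -
    \<comment> \<open>For c \<ge> 2 one has 1 + c \<le> 3(c - 1), with equality at c = 2. The total
      is then at most 3(|L| - 1), and the spare 3 absorbs the two units for the root and
      \<open>K\<close>.\<close>
    have "(\<Sum>x\<in>B. 1 + ?c x) \<le> (\<Sum>x\<in>B. 3 * (?c x - 1))"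
      by (intro sum_mono) (auto simp: B_def)
    then have "card B + (\<Sum>x\<in>B. ?c x) \<le> 3 * (\<Sum>x\<in>B. ?c x - 1)"
      by (simp only: sum.distrib sum_distrib_left card_eq_sum)
    moreover have "(\<Sum>x\<in>B. ?c x - 1) + 1 = card L"
      unfolding B_def L_def by (rule sum_branching)
    ultimately show ?thesis by linarith
  qed
  finally show ?thesis using LM unfolding U_def N_def by linarith
qed

end

section \<open>Existence of search trees and translation from graphs\<close>

lemma connected_on_bfs_tree:
  assumes "finite S" "sym E" "\<And>x. (x, x) \<notin> E" "r \<in> S" "connected_on E S"
  obtains p lev where "bfs_tree E S r p lev"
proof -
  let ?R = "Restr E S"
  \<comment> \<open>Levels are distances from \<open>r\<close> inside \<open>S\<close>; a parent
    will be a predecessor on a shortest path.\<close>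
  define lev where "lev x = (LEAST n. (r, x) \<in> ?R ^^ n)" for x
  have lev: "(r, x) \<in> ?R ^^ lev x" if "x \<in> S" for x
  proof -
    have "(r, x) \<in> ?R\<^sup>*" using assms that by (auto simp: connected_on_def)
    then show ?thesis unfolding lev_def by (auto simp: rtrancl_power intro: LeastI)
  qed
  have lev_le: "lev x \<le> n" if "(r, x) \<in> ?R ^^ n" for x n
    unfolding lev_def using that by (rule Least_le)
  have lev_edge: "lev v \<le> Suc (lev u)" if "u \<in> S" "v \<in> S" "(u, v) \<in> E" for u v
    using lev[of u] that by (intro lev_le relpow_Suc_I) auto
  have "\<exists>z. z \<in> S \<and> (u, z) \<in> E \<and> lev u = Suc (lev z)" if "u \<in> S" "u \<noteq> r" for u
  proof -
    have "lev u \<noteq> 0" using lev[OF that(1)] that(2) by (metis relpow_0_E)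
    then obtain m where m: "lev u = Suc m" using not0_implies_Suc by blast
    with lev[OF that(1)] obtain z where z: "(r, z) \<in> ?R ^^ m" "(z, u) \<in> ?R"
      by (metis relpow_Suc_E)
    with assms(2) have "(u, z) \<in> E" by (auto dest: symD)
    \<comment> \<open>The walk to \<open>z\<close> gives \<open>lev z \<le> m\<close>, and the edge
      to \<open>u\<close> gives the reverse inequality.\<close>
    then show ?thesis using z m lev_le[OF z(1)] lev_edge[of z u] by auto
  qed
  then obtain p where
    "\<And>u. u \<in> S \<Longrightarrow> u \<noteq> r \<Longrightarrow> p u \<in> S \<and> (u, p u) \<in> E \<and> lev u = Suc (lev (p u))"
    by metis
  then have "bfs_tree E S r p lev"
    using assms lev_edge by unfold_locales auto
  then show thesis by (rule that)
qed

text \<open>Arcs are symmetric, so symmetric closure adds nothing, and \<open>rtrancl_on\<close>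
  agrees with ordinary closure for endpoints in \<open>S\<close>.\<close>

lemma (in graph) connected_induce_iff:
  "Digraph_Component.connected (G \<restriction> S) \<longleftrightarrow> S \<noteq> {} \<and> connected_on (arcs_ends G) S"
proof -
  let ?R = "Restr (arcs_ends G) S"
  have ends: "arcs_ends (G \<restriction> S) = ?R"
    by (auto simp: arcs_ends_conv)
  have "sym ?R" using sym_arcs by (auto simp: symmetric_def sym_def)
  then have "symcl ?R = ?R" by (auto simp: symcl_def dest: symD)
  moreover have "(x, y) \<in> rtrancl_on S ?R \<longleftrightarrow> (x, y) \<in> ?R\<^sup>*" if "x \<in> S" "y \<in> S" for x y
    using that by (auto intro: rtrancl_consistent_rtrancl_on dest: rtrancl_on_rtranclI)
  ultimately show ?thesis
    by (simp add: connected_conv connected_on_def ends)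
qed

section \<open>Private neighbours and the final count\<close>

theorem lemma9:
  fixes G :: "('a, 'b) pre_digraph" and S :: "'a set" and n :: nat
  assumes "graph G"
    and "card (verts G) = n"
    and "minimal_connected_dominating_set G S"
    and "real (card S) \<ge> 4 / 10 * real n"
  shows "real (card (low_degree_vertices G S)) \<ge> 1 / 20 * real n"
proof -
  interpret graph G by fact
  let ?E = "arcs_ends G"
  have sym: "sym ?E" using sym_arcs by (simp add: symmetric_def)
  have irrefl: "(x, x) \<notin> ?E" for x using no_loops by (auto simp: arcs_ends_conv)
  have S: "S \<subseteq> verts G" and conn: "S \<noteq> {}" "connected_on ?E S"
    and dom: "\<And>v. v \<in> verts G - S \<Longrightarrow> \<exists>u\<in>S. (v, u) \<in> ?E"
    and minimal: "\<And>T. T \<subset> S \<Longrightarrow> \<not> connected_dominating_set G T"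
  proof -
    show S: "S \<subseteq> verts G"
      using assms(3) unfolding minimal_connected_dominating_set_def connected_dominating_set_def
        dominating_set_def by blast
    have "Digraph_Component.connected (G \<restriction> S)"
      using assms(3) unfolding minimal_connected_dominating_set_def connected_dominating_set_def
      by blast
    then show "S \<noteq> {}" "connected_on ?E S" using connected_induce_iff[of S] by blast+
    show "\<exists>u\<in>S. (v, u) \<in> ?E" if "v \<in> verts G - S" for v
      using assms(3) that unfolding minimal_connected_dominating_set_def
        connected_dominating_set_def dominating_set_def neighbors_def by blast
    show "\<not> connected_dominating_set G T" if "T \<subset> S" for T
      using assms(3) that unfolding minimal_connected_dominating_set_def by blast
  qed
  have finS: "finite S" using S finite_verts by (rule finite_subset)
  have nbrs: "neighbors G v \<inter> S = ?E `` {v} \<inter> S" for v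
    using S by (auto simp: neighbors_def)
  have finL: "finite (low_degree_vertices G S)" by (simp add: low_degree_vertices_def)
  show ?thesis
  proof (cases "2 \<le> card S")
    case False
    \<comment> \<open>With at most one vertex in \<open>S\<close>, every vertex of the graph is
      low.\<close>
    then have "card (neighbors G v \<inter> S) \<le> 2" for v
      using card_mono[OF finS, of "neighbors G v \<inter> S"] by auto
    then have "low_degree_vertices G S = verts G" by (auto simp: low_degree_vertices_def)
    then show ?thesis using assms(2) by simp
  next
    case True
    define N where "N = {x \<in> S. connected_on ?E (S - {x})}"
    define U where "U = {u \<in> S. 3 \<le> card (?E `` {u} \<inter> S)}"
    obtain r where r: "r \<in> S" using conn by blast
    obtain p lev where "bfs_tree ?E S r p lev"
      using connected_on_bfs_tree[OF finS sym irrefl r conn(2)] .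
    then have UN: "card U \<le> 4 * card N"
      unfolding U_def N_def using True by (rule bfs_tree.card_degree_ge_3_le)
    have "\<exists>w. w \<in> verts G - S \<and> ?E `` {w} \<inter> S = {x}" if "x \<in> N" for x
    proof -
      from that have x: "x \<in> S" "connected_on ?E (S - {x})" by (auto simp: N_def)
      have "S \<noteq> {x}" using True by auto
      then obtain y where y: "y \<in> S" "y \<noteq> x" using x by blast
      then have "(x, y) \<in> (Restr ?E S)\<^sup>*" using conn(2) x by (auto simp: connected_on_def)
      then obtain z where z: "(x, z) \<in> ?E" "z \<in> S" using y by (auto elim: converse_rtranclE)
      with irrefl have "z \<noteq> x" by auto
      have "Digraph_Component.connected (G \<restriction> (S - {x}))"
        using connected_induce_iff[of "S - {x}"] x y by auto
      \<comment> \<open>Since \<open>S - {x}\<close> is still connected, minimality can only be due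
        to a failure of domination.\<close>
      then have "\<not> dominating_set G (S - {x})"
        using minimal[of "S - {x}"] x by (auto simp: connected_dominating_set_def)
      then obtain w where w: "w \<in> verts G" "w \<notin> S - {x}" "\<forall>u\<in>S - {x}. (w, u) \<notin> ?E"
        using S by (auto simp: dominating_set_def neighbors_def)
      \<comment> \<open>The undominated vertex might be \<open>x\<close> itself, but
        \<open>x\<close> has the neighbour \<open>z\<close> in \<open>S - {x}\<close>. So
        \<open>w\<close> is outside \<open>S\<close>, and only \<open>x\<close> dominates
        it.\<close>
      then have "w \<noteq> x" using z \<open>z \<noteq> x\<close> by auto
      with w dom[of w] have "?E `` {w} \<inter> S = {x}" by blast
      with w \<open>w \<noteq> x\<close> show ?thesis by blast
    qed
    then obtain priv where priv: "\<And>x. x \<in> N \<Longrightarrow> priv x \<in> verts G - S \<and> ?E `` {priv x} \<inter> S = {x}"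
      by metis
    have "inj_on priv N" by (rule inj_onI) (metis priv the_elem_eq)
    then have cardN: "card (priv ` N) = card N" by (rule card_image)
    have "priv ` N \<union> (S - U) \<subseteq> low_degree_vertices G S"
      using S priv by (auto simp: low_degree_vertices_def nbrs U_def)
    moreover have "priv ` N \<inter> (S - U) = {}" using priv by blast
    moreover have "finite N" using finS by (simp add: N_def)
    ultimately have "card N + card (S - U) \<le> card (low_degree_vertices G S)"
      using cardN finS finL by (metis card_Un_disjoint card_mono finite_Diff finite_imageI)
    moreover have "card S \<le> card U + card (S - U)"
    proof -
      have "U \<union> (S - U) = S" by (auto simp: U_def)
      then show ?thesis using card_Un_le[of U "S - U"] by simp
    qed
    ultimately have "card S \<le> 4 * card (low_degree_vertices G S)" using UN by linarith
    \<comment> \<open>The bound |S|/4 already yields n/10, twice what is claimed.\<close>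
    then show ?thesis using assms(4) by linarith
  qed
qed

end
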